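(* Every global (respectively, local) $l$-minimal solution of the set-valued formulation is a global (respectively, local) real optimistic solution of the bilevel problem. Similarly, every global (respectively, local) $u$-minimal solution of the set-valued formulation is a global (respectively, local) real pessimistic solution of the bilevel problem. If $F(x,\psi(x))$ is a closed subset of $\mathbb{R}$ for every $x\in X$, then the converses hold: every global (respectively, local) real optimistic solution of the bilevel problem is a global (respectively, local) $l$-minimal solution of the set-valued formulation, and every global (respectively, local) real pessimistic solution of the bilevel problem is a global (respectively, local) $u$-minimal solution of the set-valued formulation.
   Context: Setting. $\mathcal{X},\mathcal{Y}$ are real normed linear spaces, $X\subseteq\mathcal{X}$ is nonempty, $F:\mathcal{X}\times\mathcal{Y}\to\mathbb{R}$ is the upper-level objective. For each $x\in X$, $K(x)\subseteq\mathcal{Y}$ is the lower-level constraint set, $f$ is the real-valued lower-level objective, and $\psi(x)=\arg\min_y\{f(x,y)\mid y\in K(x)\}$ is the set of global minimizers of $f(x,\cdot)$ over $K(x)$. Standing assumption: $\psi(x)\neq\emptyset$ for every $x\in X$. The bilevel problem is: "minimize" over $x$ the value $F(x,y)$ subject to $x\in X$, $y\in\psi(x)$. For $x\in X$, $F_o(x)=\inf_{y\in\psi(x)}F(x,y)$ and $F_p(x)=\sup_{y\in\psi(x)}F(x,y)$ (possibly $-\infty$, respectively $+\infty$; attainment is not assumed). A point $x^*\in X$ is a global real optimistic (respectively, pessimistic) solution of the bilevel problem if $F_o(x)\ge F_o(x^* )$ (respectively, $F_p(x)\ge F_p(x^* )$) for all $x\in X$; it is a local real optimistic (respectively, pessimistic)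 solution if there is $\epsilon>0$ such that this inequality holds for all $x\in X$ with $\|x-x^*\|<\epsilon$. Set-valued formulation: minimize $F(x,\psi(x))$ over $x\in X$, where $F(x,\psi(x)):=\{F(x,y)\mid y\in\psi(x)\}\subseteq\mathbb{R}$. $\mathbb{R}$ carries its usual order, induced by the cone $C=\mathbb{R}_+=[0,\infty)$. For nonempty $A,B\subseteq\mathbb{R}$, $A\le_C^l B$ means $B\subseteq A+C$, and $A\le_C^u B$ means $A\subseteq B-C$. For $\ast\in\{l,u\}$, a point $x^0\in X$ is a global $\ast$-minimal solution of the set-valued formulation if for every $x\in X$ with $F(x,\psi(x))\le_C^{\ast} F(x^0,\psi(x^0))$ one has $F(x^0,\psi(x^0))\le_C^{\ast} F(x,\psi(x))$; it is a local $\ast$-minimal solution if there is $\epsilon>0$ such that this implication holds for every $x\in X$ with $\|x-x^0\|<\epsilon$. *)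

theory Defs
  imports Complex_Main "HOL-Library.Extended_Real"
begin

definition lower_argmin :: "('a \<Rightarrow> 'b \<Rightarrow> real) \<Rightarrow> ('a \<Rightarrow> 'b set) \<Rightarrow> 'a \<Rightarrow> 'b set" where
  "lower_argmin f K x = {y. is_arg_min (f x) (\<lambda>z. z \<in> K x) y}"

text \<open>The optimal values are extended reals: the infimum may be \<open>-\<infinity>\<close> and the supremum
  \<open>\<infinity>\<close>, and neither need be attained.\<close>

definition F_opt :: "('a \<Rightarrow> 'b \<Rightarrow> real) \<Rightarrow> ('a \<Rightarrow> 'b set) \<Rightarrow> 'a \<Rightarrow> ereal" where
  "F_opt F \<psi> x = (INF y\<in>\<psi> x. ereal (F x y))"

definition F_pes :: "('a \<Rightarrow> 'b \<Rightarrow> real) \<Rightarrow> ('a \<Rightarrow> 'b set) \<Rightarrow> 'a \<Rightarrow> ereal" where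
  "F_pes F \<psi> x = (SUP y\<in>\<psi> x. ereal (F x y))"

definition global_optimistic_solution ::
  "'a set \<Rightarrow> ('a \<Rightarrow> 'b \<Rightarrow> real) \<Rightarrow> ('a \<Rightarrow> 'b set) \<Rightarrow> 'a \<Rightarrow> bool" where
  "global_optimistic_solution X F \<psi> x0 \<longleftrightarrow>
     x0 \<in> X \<and> (\<forall>x\<in>X. F_opt F \<psi> x \<ge> F_opt F \<psi> x0)"

definition local_optimistic_solution ::
  "'a::real_normed_vector set \<Rightarrow> ('a \<Rightarrow> 'b \<Rightarrow> real) \<Rightarrow> ('a \<Rightarrow> 'b set) \<Rightarrow> 'a \<Rightarrow> bool" where
  "local_optimistic_solution X F \<psi> x0 \<longleftrightarrow>
     x0 \<in> X \<and> (\<exists>\<epsilon>>0. \<forall>x\<in>X. norm (x - x0) < \<epsilon> \<longrightarrow> F_opt F \<psi> x \<ge> F_opt F \<psi> x0)"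

definition global_pessimistic_solution ::
  "'a set \<Rightarrow> ('a \<Rightarrow> 'b \<Rightarrow> real) \<Rightarrow> ('a \<Rightarrow> 'b set) \<Rightarrow> 'a \<Rightarrow> bool" where
  "global_pessimistic_solution X F \<psi> x0 \<longleftrightarrow>
     x0 \<in> X \<and> (\<forall>x\<in>X. F_pes F \<psi> x \<ge> F_pes F \<psi> x0)"

definition local_pessimistic_solution ::
  "'a::real_normed_vector set \<Rightarrow> ('a \<Rightarrow> 'b \<Rightarrow> real) \<Rightarrow> ('a \<Rightarrow> 'b set) \<Rightarrow> 'a \<Rightarrow> bool" where
  "local_pessimistic_solution X F \<psi> x0 \<longleftrightarrow>
     x0 \<in> X \<and> (\<exists>\<epsilon>>0. \<forall>x\<in>X. norm (x - x0) < \<epsilon> \<longrightarrow> F_pes F \<psi> x \<ge> F_pes F \<psi> x0)"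

text \<open>The sum and difference with the cone \<open>C\<close> are elementwise (Minkowski); in particular
  the difference is not set difference.\<close>

definition set_le_l :: "real set \<Rightarrow> real set \<Rightarrow> real set \<Rightarrow> bool" where
  "set_le_l C A B \<longleftrightarrow> B \<subseteq> {a + c | a c. a \<in> A \<and> c \<in> C}"

definition set_le_u :: "real set \<Rightarrow> real set \<Rightarrow> real set \<Rightarrow> bool" where
  "set_le_u C A B \<longleftrightarrow> A \<subseteq> {b - c | b c. b \<in> B \<and> c \<in> C}"

definition objective_set :: "('a \<Rightarrow> 'b \<Rightarrow> real) \<Rightarrow> ('a \<Rightarrow> 'b set) \<Rightarrow> 'a \<Rightarrow> real set" where
  "objective_set F \<psi> x = {F x y | y. y \<in> \<psi> x}"

definition global_minimal_solution ::
  "(real set \<Rightarrow> real set \<Rightarrow> bool) \<Rightarrow> 'a set \<Rightarrow> ('a \<Rightarrow> real set) \<Rightarrow> 'a \<Rightarrow> bool" where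
  "global_minimal_solution le X G x0 \<longleftrightarrow>
     x0 \<in> X \<and> (\<forall>x\<in>X. le (G x) (G x0) \<longrightarrow> le (G x0) (G x))"

definition local_minimal_solution ::
  "(real set \<Rightarrow> real set \<Rightarrow> bool) \<Rightarrow> 'a::real_normed_vector set \<Rightarrow> ('a \<Rightarrow> real set) \<Rightarrow> 'a \<Rightarrow> bool" where
  "local_minimal_solution le X G x0 \<longleftrightarrow>
     x0 \<in> X \<and> (\<exists>\<epsilon>>0. \<forall>x\<in>X. norm (x - x0) < \<epsilon> \<longrightarrow> le (G x) (G x0) \<longrightarrow> le (G x0) (G x))"

abbreviation "global_l_minimal \<equiv> global_minimal_solution (set_le_l {0..})"
abbreviation "local_l_minimal \<equiv> local_minimal_solution (set_le_l {0..})"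
abbreviation "global_u_minimal \<equiv> global_minimal_solution (set_le_u {0..})"
abbreviation "local_u_minimal \<equiv> local_minimal_solution (set_le_u {0..})"

end

theory Submission
  imports Defs "HOL-Analysis.Topology_Euclidean_Space"
begin

text \<open>
  Over the cone \<open>[0, \<infinity>)\<close>, the relation \<open>A \<le>\<^sup>l B\<close> says that every element of \<open>B\<close> has a lower or
  equal element in \<open>A\<close>. It is therefore squeezed between two comparisons of infima:
  \<open>inf A < inf B\<close> implies \<open>A \<le>\<^sup>l B\<close>, which implies \<open>inf A \<le> inf B\<close>
  (\<open>set_le_l_if_Inf_less\<close>, \<open>Inf_le_if_set_le_l\<close>). Only the case of equal infima is not
  decided by the infima: there \<open>A \<le>\<^sup>l B\<close> fails exactly when \<open>B\<close> attains the common infimum and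
  \<open>A\<close> does not. A nonempty closed set attains its infimum or is unbounded below, so that for such
  \<open>A\<close> the relation \<open>A \<le>\<^sup>l B\<close> is equivalent to \<open>inf A \<le> inf B\<close> (\<open>set_le_l_if_Inf_le\<close>). Reflection
  \<open>a \<mapsto> - a\<close> turns \<open>\<le>\<^sup>u\<close> into the reverse of \<open>\<le>\<^sup>l\<close> and suprema into negated infima, which gives the
  same three facts for \<open>\<le>\<^sup>u\<close> and suprema, the last one with \<open>B\<close> as the closed set.

  The rest is order theory. Let \<open>v x\<close> be the optimal value at \<open>x\<close>, and let \<open>x \<le> x'\<close> abbreviate the
  set relation between the objective sets at \<open>x\<close> and \<open>x'\<close>. If \<open>x0\<close> is minimal for \<open>\<le>\<close> but
  \<open>v x < v x0\<close>, then \<open>x \<le> x0\<close>, whence \<open>x0 \<le> x\<close> by minimality and \<open>v x0 \<le> v x\<close>, a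
  contradiction. Conversely, when closedness makes \<open>v x0 \<le> v x\<close> imply \<open>x0 \<le> x\<close>, a minimizer of \<open>v\<close>
  is minimal for \<open>\<le>\<close>. Since this compares \<open>x0\<close> with a single \<open>x\<close>, it serves the global and the
  local notions alike.
\<close>

lemma set_le_l_nonneg_iff: "set_le_l {0..} A B \<longleftrightarrow> (\<forall>b\<in>B. \<exists>a\<in>A. a \<le> b)"
proof -
  have "(\<exists>a c. b = a + c \<and> a \<in> A \<and> c \<in> {0..}) \<longleftrightarrow> (\<exists>a\<in>A. a \<le> b)" for b :: real
  proof
    assume "\<exists>a\<in>A. a \<le> b"
    then obtain a where "a \<in> A" "a \<le> b" by blast
    then show "\<exists>a c. b = a + c \<and> a \<in> A \<and> c \<in> {0..}"
      by (intro exI[of _ a] exI[of _ "b - a"]) auto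
  next
    assume "\<exists>a c. b = a + c \<and> a \<in> A \<and> c \<in> {0..}"
    then obtain a c where "b = a + c" "a \<in> A" "c \<ge> 0" by auto
    then show "\<exists>a\<in>A. a \<le> b" by (intro bexI[of _ a]) auto
  qed
  then show ?thesis
    unfolding set_le_l_def by blast
qed

lemma set_le_u_nonneg_iff: "set_le_u {0..} A B \<longleftrightarrow> (\<forall>a\<in>A. \<exists>b\<in>B. a \<le> b)"
proof -
  have "(\<exists>b c. a = b - c \<and> b \<in> B \<and> c \<in> {0..}) \<longleftrightarrow> (\<exists>b\<in>B. a \<le> b)" for a :: real
  proof
    assume "\<exists>b\<in>B. a \<le> b"
    then obtain b where "b \<in> B" "a \<le> b" by blast
    then show "\<exists>b c. a = b - c \<and> b \<in> B \<and> c \<in> {0..}"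
      by (intro exI[of _ b] exI[of _ "b - a"]) auto
  next
    assume "\<exists>b c. a = b - c \<and> b \<in> B \<and> c \<in> {0..}"
    then obtain b c where "a = b - c" "b \<in> B" "c \<ge> 0" by auto
    then show "\<exists>b\<in>B. a \<le> b" by (intro bexI[of _ b]) auto
  qed
  then show ?thesis
    unfolding set_le_u_def by blast
qed

lemma set_le_u_iff_set_le_l_uminus:
  "set_le_u {0..} A B \<longleftrightarrow> set_le_l {0..} (uminus ` B) (uminus ` A)"
  by (auto simp: set_le_l_nonneg_iff set_le_u_nonneg_iff)

lemma SUP_ereal_eq_uminus_INF: "(SUP a\<in>A. ereal a) = - (INF a\<in>uminus ` A. ereal a)"
  using ereal_INF_uminus_eq[of ereal A] by (simp add: image_comp comp_def)

lemma Inf_le_if_set_le_l: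
  assumes "set_le_l {0..} A B"
  shows "(INF a\<in>A. ereal a) \<le> (INF b\<in>B. ereal b)"
  using assms unfolding set_le_l_nonneg_iff by (intro INF_mono) simp

text \<open>
  An element of \<open>A\<close> strictly below \<open>inf B\<close> lies below all of \<open>B\<close> at once.
\<close>

lemma set_le_l_if_Inf_less:
  assumes "(INF a\<in>A. ereal a) < (INF b\<in>B. ereal b)"
  shows "set_le_l {0..} A B"
proof -
  obtain a where "a \<in> A" and less: "ereal a < (INF b\<in>B. ereal b)"
    using assms by (auto simp: INF_less_iff)
  have "a \<le> b" if "b \<in> B" for b
    using less_le_trans[OF less INF_lower[OF that]] by simp
  with \<open>a \<in> A\<close> show ?thesis
    unfolding set_le_l_nonneg_iff by blast
qed

text \<open>
  If \<open>A\<close> is bounded below, then, being closed, it has a least element, which serves every element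
  of \<open>B\<close>; otherwise \<open>A\<close> has elements below any given number.
\<close>

lemma set_le_l_if_Inf_le:
  assumes "closed A" "A \<noteq> {}" and le: "(INF a\<in>A. ereal a) \<le> (INF b\<in>B. ereal b)"
  shows "set_le_l {0..} A B"
  unfolding set_le_l_nonneg_iff
proof
  fix b assume "b \<in> B"
  show "\<exists>a\<in>A. a \<le> b"
  proof (cases "bdd_below A")
    case True
    then have "Inf A \<in> A"
      using assms closed_contains_Inf by blast
    moreover have "ereal (Inf A) \<le> (INF a\<in>A. ereal a)"
      using True by (intro INF_greatest) (simp add: cInf_lower)
    then have "ereal (Inf A) \<le> ereal b"
      using le INF_lower[OF \<open>b \<in> B\<close>, of ereal] by (meson order_trans)
    ultimately show ?thesis
      by auto
  next
    case False
    then show ?thesis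
      unfolding bdd_below_def by (meson linear)
  qed
qed

lemma Sup_le_if_set_le_u:
  assumes "set_le_u {0..} A B"
  shows "(SUP a\<in>A. ereal a) \<le> (SUP b\<in>B. ereal b)"
  using Inf_le_if_set_le_l assms
  unfolding SUP_ereal_eq_uminus_INF set_le_u_iff_set_le_l_uminus ereal_minus_le_minus by blast

lemma set_le_u_if_Sup_less:
  assumes "(SUP a\<in>A. ereal a) < (SUP b\<in>B. ereal b)"
  shows "set_le_u {0..} A B"
  using set_le_l_if_Inf_less assms
  unfolding SUP_ereal_eq_uminus_INF set_le_u_iff_set_le_l_uminus ereal_minus_less_minus by blast

text \<open>
  Under reflection the two sets swap places, so closedness is now asked of the right-hand set \<open>B\<close>.
\<close>

lemma set_le_u_if_Sup_le:
  assumes "closed B" "B \<noteq> {}" and "(SUP a\<in>A. ereal a) \<le> (SUP b\<in>B. ereal b)"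
  shows "set_le_u {0..} A B"
proof -
  have "closed (uminus ` B)"
    using assms(1) by (rule closed_negations)
  with assms show ?thesis
    using set_le_l_if_Inf_le[of "uminus ` B" "uminus ` A"]
    unfolding SUP_ereal_eq_uminus_INF set_le_u_iff_set_le_l_uminus ereal_minus_le_minus by blast
qed

lemma F_opt_eq_INF_objective_set: "F_opt F \<psi> x = (INF a\<in>objective_set F \<psi> x. ereal a)"
  by (simp add: F_opt_def objective_set_def setcompr_eq_image image_comp comp_def)

lemma F_pes_eq_SUP_objective_set: "F_pes F \<psi> x = (SUP a\<in>objective_set F \<psi> x. ereal a)"
  by (simp add: F_pes_def objective_set_def setcompr_eq_image image_comp comp_def)

text \<open>
  The pointwise comparison behind the first half of the theorem: the hypothesis is what minimality
  of \<open>x0\<close> says about one competitor \<open>x\<close>. By linearity of the extended reals, failure of the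
  conclusion is the strict inequality that produces the premise of the hypothesis.
\<close>

lemma F_opt_le_if_l_minimal_at:
  assumes "set_le_l {0..} (objective_set F \<psi> x) (objective_set F \<psi> x0) \<longrightarrow>
    set_le_l {0..} (objective_set F \<psi> x0) (objective_set F \<psi> x)"
  shows "F_opt F \<psi> x0 \<le> F_opt F \<psi> x"
  using assms Inf_le_if_set_le_l set_le_l_if_Inf_less
  unfolding F_opt_eq_INF_objective_set by (meson not_le)

lemma F_pes_le_if_u_minimal_at:
  assumes "set_le_u {0..} (objective_set F \<psi> x) (objective_set F \<psi> x0) \<longrightarrow>
    set_le_u {0..} (objective_set F \<psi> x0) (objective_set F \<psi> x)"
  shows "F_pes F \<psi> x0 \<le> F_pes F \<psi> x"
  using assms Sup_le_if_set_le_u set_le_u_if_Sup_less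
  unfolding F_pes_eq_SUP_objective_set by (meson not_le)

theorem proposition11:
  fixes X :: "'a::real_normed_vector set"
    and F f :: "'a \<Rightarrow> 'b::real_normed_vector \<Rightarrow> real"
    and K \<psi> :: "'a \<Rightarrow> 'b set"
  assumes "X \<noteq> {}"
    and "\<psi> = lower_argmin f K"
    and "\<And>x. x \<in> X \<Longrightarrow> \<psi> x \<noteq> {}"
  shows
    "(\<forall>x0. global_l_minimal X (objective_set F \<psi>) x0 \<longrightarrow> global_optimistic_solution X F \<psi> x0) \<and>
     (\<forall>x0. local_l_minimal X (objective_set F \<psi>) x0 \<longrightarrow> local_optimistic_solution X F \<psi> x0) \<and>
     (\<forall>x0. global_u_minimal X (objective_set F \<psi>) x0 \<longrightarrow> global_pessimistic_solution X F \<psi> x0) \<and>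
     (\<forall>x0. local_u_minimal X (objective_set F \<psi>) x0 \<longrightarrow> local_pessimistic_solution X F \<psi> x0) \<and>
     ((\<forall>x\<in>X. closed (objective_set F \<psi> x)) \<longrightarrow>
       (\<forall>x0. global_optimistic_solution X F \<psi> x0 \<longrightarrow> global_l_minimal X (objective_set F \<psi>) x0) \<and>
       (\<forall>x0. local_optimistic_solution X F \<psi> x0 \<longrightarrow> local_l_minimal X (objective_set F \<psi>) x0) \<and>
       (\<forall>x0. global_pessimistic_solution X F \<psi> x0 \<longrightarrow> global_u_minimal X (objective_set F \<psi>) x0) \<and>
       (\<forall>x0. local_pessimistic_solution X F \<psi> x0 \<longrightarrow> local_u_minimal X (objective_set F \<psi>) x0))"
proof -
  let ?G = "objective_set F \<psi>"
  have nonempty: "?G x \<noteq> {}" if "x \<in> X" for x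
    using assms(3)[OF that] by (auto simp: objective_set_def)
  have l_if_opt: "set_le_l {0..} (?G x0) (?G x)"
    if "\<forall>x\<in>X. closed (?G x)" "x0 \<in> X" "F_opt F \<psi> x0 \<le> F_opt F \<psi> x" for x0 x
    using that nonempty set_le_l_if_Inf_le unfolding F_opt_eq_INF_objective_set by blast
  have u_if_pes: "set_le_u {0..} (?G x0) (?G x)"
    if "\<forall>x\<in>X. closed (?G x)" "x \<in> X" "F_pes F \<psi> x0 \<le> F_pes F \<psi> x" for x0 x
    using that nonempty set_le_u_if_Sup_le unfolding F_pes_eq_SUP_objective_set by blast
  note solution_defs = global_minimal_solution_def local_minimal_solution_def
    global_optimistic_solution_def local_optimistic_solution_def
    global_pessimistic_solution_def local_pessimistic_solution_def
  note opt_at = F_opt_le_if_l_minimal_at[of F \<psi>]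
  note pes_at = F_pes_le_if_u_minimal_at[of F \<psi>]
  have optimistic_if_global: "global_optimistic_solution X F \<psi> x0"
    if "global_l_minimal X ?G x0" for x0
    using that opt_at unfolding solution_defs by metis
  have pessimistic_if_global: "global_pessimistic_solution X F \<psi> x0"
    if "global_u_minimal X ?G x0" for x0
    using that pes_at unfolding solution_defs by metis
  have optimistic_if_local: "local_optimistic_solution X F \<psi> x0"
    if "local_l_minimal X ?G x0" for x0
    using that opt_at unfolding solution_defs by metis
  have pessimistic_if_local: "local_pessimistic_solution X F \<psi> x0"
    if "local_u_minimal X ?G x0" for x0
    using that pes_at unfolding solution_defs by metis
  have l_minimal_if_global: "global_l_minimal X ?G x0"
    if "\<forall>x\<in>X. closed (?G x)" and "global_optimistic_solution X F \<psi> x0" for x0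
    using that l_if_opt unfolding solution_defs by metis
  have u_minimal_if_global: "global_u_minimal X ?G x0"
    if "\<forall>x\<in>X. closed (?G x)" and "global_pessimistic_solution X F \<psi> x0" for x0
    using that u_if_pes unfolding solution_defs by metis
  have l_minimal_if_local: "local_l_minimal X ?G x0"
    if "\<forall>x\<in>X. closed (?G x)" and "local_optimistic_solution X F \<psi> x0" for x0
    using that l_if_opt unfolding solution_defs by metis
  have u_minimal_if_local: "local_u_minimal X ?G x0"
    if "\<forall>x\<in>X. closed (?G x)" and "local_pessimistic_solution X F \<psi> x0" for x0
    using that u_if_pes unfolding solution_defs by metis
  show ?thesis
    by (simp add: optimistic_if_global optimistic_if_local pessimistic_if_global
        pessimistic_if_local l_minimal_if_global l_minimal_if_local
        u_minimal_if_global u_minimal_if_local)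
qed

end
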